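(* Let $n,m,N\ge 1$, $\gamma\in(0,1)$, $A\in\mathbb{R}^{n\times n}$, $B\in\mathbb{R}^{n\times m}$ with $(A,B)$ stabilizable, and consider the stochastic linear system $x^+=Ax+Bu+\xi$ and value functions $v$ of the form $v(x)=x^\intercal Px+e$ with $P\in\mathbb{R}^{n\times n}$ symmetric and $e$ constant. Let $$G(x,u,\xi)=xx^\intercal-\gamma(Ax+Bu+\xi)(Ax+Bu+\xi)^\intercal .$$ Let $(X,U,X^+)$ be a dataset of length $N$ from this system, i.e. $X=[x^1\ \cdots\ x^N]\in\mathbb{R}^{n\times N}$, $U=[u^1\ \cdots\ u^N]\in\mathbb{R}^{m\times N}$, and the $k$-th column of $X^+\in\mathbb{R}^{n\times N}$ is $Ax^k+Bu^k+\xi^k$, where $\xi^1,\dots,\xi^N\in\mathbb{R}^n$ are the corresponding noise realizations. Let $\bar x=\tfrac1N X\mathbf{1}$, $\bar u=\tfrac1N U\mathbf{1}$, $\bar x^+=\tfrac1N X^+\mathbf{1}$ and $\bar\xi=\tfrac1N\sum_{k=1}^N\xi^k$. Then $$G(\bar x,\bar u,\bar\xi)=\bar x\,\bar x^\intercal-\gamma\,\bar x^+\,(\bar x^{+})^\intercal .$$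
   Context: $\mathbf{1}\in\mathbb{R}^N$ denotes the vector of all ones. The noise is i.i.d. with zero mean and covariance matrix $\Sigma$. The map $G$ collects the coefficients of the entries of $P$ in the Bellman inequality $x^\intercal Px\le\ell(x,u)+\gamma (Ax+Bu+\xi)^\intercal P(Ax+Bu+\xi)$ for the stage cost $\ell(x,u)=\begin{bmatrix}x\\ u\end{bmatrix}^\intercal L\begin{bmatrix}x\\ u\end{bmatrix}$, where $L=\begin{bmatrix}L_{xx}&L_{xu}\\ L_{xu}^\intercal&L_{uu}\end{bmatrix}$ is symmetric with $L\succeq 0$ and $L_{uu}\succ 0$. *)

theory Defs
  imports "HOL-Probability.Probability"
begin

definition next_state ::
  "real^'n^'n \<Rightarrow> real^'m^'n \<Rightarrow> real^'n \<Rightarrow> real^'m \<Rightarrow> real^'n \<Rightarrow> real^'n" where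
  "next_state A B x u \<xi> = A *v x + B *v u + \<xi>"

(* Discrete time: every complex eigenvalue lies in the open unit disc. *)
definition schur_stable :: "real^'n^'n \<Rightarrow> bool" where
  "schur_stable M \<longleftrightarrow>
     (\<forall>(\<mu>::complex) v. v \<noteq> 0 \<and> (\<chi> i j. complex_of_real (M $ i $ j)) *v v = \<mu> *s v
        \<longrightarrow> norm \<mu> < 1)"

definition stabilizable :: "real^'n^'n \<Rightarrow> real^'m^'n \<Rightarrow> bool" where
  "stabilizable A B \<longleftrightarrow> (\<exists>K :: real^'n^'m. schur_stable (A + B ** K))"

definition psd :: "real^'n^'n \<Rightarrow> bool" where
  "psd M \<longleftrightarrow> transpose M = M \<and> (\<forall>z. 0 \<le> z \<bullet> (M *v z))"

definition pd :: "real^'n^'n \<Rightarrow> bool" where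
  "pd M \<longleftrightarrow> transpose M = M \<and> (\<forall>z. z \<noteq> 0 \<longrightarrow> 0 < z \<bullet> (M *v z))"

(* The cost matrix is indexed by the disjoint sum of state and input indices,
   so L_uu is its block at the Inr indices. *)
definition stack :: "real^'n \<Rightarrow> real^'m \<Rightarrow> real^('n + 'm)" where
  "stack x u = (\<chi> k. case k of Inl i \<Rightarrow> x $ i | Inr j \<Rightarrow> u $ j)"

definition input_block :: "real^('n::finite + 'm::finite)^('n + 'm) \<Rightarrow> real^'m^'m" where
  "input_block L = (\<chi> i j. L $ Inr i $ Inr j)"

definition stage_cost ::
  "real^('n::finite + 'm::finite)^('n + 'm) \<Rightarrow> real^'n \<Rightarrow> real^'m \<Rightarrow> real" where
  "stage_cost L x u = stack x u \<bullet> (L *v stack x u)"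

(* As the mean is zero, the covariance matrix is the matrix of second moments. *)
definition iid_noise :: "'w measure \<Rightarrow> ('k \<Rightarrow> 'w \<Rightarrow> real^'n) \<Rightarrow> real^'n^'n \<Rightarrow> bool" where
  "iid_noise M w \<Sigma> \<longleftrightarrow>
     prob_space M \<and>
     prob_space.indep_vars M (\<lambda>_. borel) w UNIV \<and>
     (\<forall>k l. distr M borel (w k) = distr M borel (w l)) \<and>
     (\<forall>k. integrable M (w k) \<and> integral\<^sup>L M (w k) = 0) \<and>
     (\<forall>k i j. integrable M (\<lambda>\<omega>. w k \<omega> $ i * w k \<omega> $ j) \<and>
              integral\<^sup>L M (\<lambda>\<omega>. w k \<omega> $ i * w k \<omega> $ j) = \<Sigma> $ i $ j)"

definition outer :: "real^'n \<Rightarrow> real^'n^'n" where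
  "outer x = (columnvector x :: real^1^'n) ** (rowvector x :: real^'n^1)"

definition G ::
  "real^'n^'n \<Rightarrow> real^'m^'n \<Rightarrow> real \<Rightarrow> real^'n \<Rightarrow> real^'m \<Rightarrow> real^'n \<Rightarrow> real^'n^'n" where
  "G A B \<gamma> x u \<xi> = outer x - \<gamma> *\<^sub>R outer (next_state A B x u \<xi>)"

definition quad_value :: "real^'n^'n \<Rightarrow> real \<Rightarrow> real^'n \<Rightarrow> real" where
  "quad_value P e x = x \<bullet> (P *v x) + e"

(* The inner product on matrices is the entrywise (Frobenius) one, so the following lemmas
   exhibit G as the matrix of coefficients of the entries of P in the Bellman inequality. *)
lemma inner_outer: "P \<bullet> outer x = x \<bullet> (P *v x)"
  by (simp add: outer_def columnvector_def rowvector_def matrix_matrix_mult_def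
      inner_vec_def matrix_vector_mult_def sum_distrib_left mult_ac)

lemma quad_value_diff:
  "quad_value P e x - \<gamma> * quad_value P e (next_state A B x u \<xi>)
     = P \<bullet> G A B \<gamma> x u \<xi> + (1 - \<gamma>) * e"
  by (simp add: G_def quad_value_def inner_diff_right inner_outer algebra_simps)

lemma bellman_iff_G:
  "x \<bullet> (P *v x) \<le> stage_cost L x u
       + \<gamma> * (next_state A B x u \<xi> \<bullet> (P *v next_state A B x u \<xi>))
     \<longleftrightarrow> P \<bullet> G A B \<gamma> x u \<xi> \<le> stage_cost L x u"
  by (auto simp add: G_def inner_diff_right inner_outer)

end

theory Submission
  imports Defs
begin

text \<open>The dynamics are affine with no constant term, hence jointly linear in state, input and
  noise. Averaging therefore commutes with them: the mean successor state is the successor of the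
  mean state under the mean input and the mean noise realization. So \<open>(xbar, ubar, \<xi>bar)\<close> is itself
  an admissible transition with successor \<open>xpbar\<close>, and evaluating \<open>G\<close> on it needs only the data.\<close>

lemma mult_one_eq_sum_columns: "(Z :: real^'k^'i) *v 1 = (\<Sum>k\<in>UNIV. column k Z)"
  by (simp add: matrix_mult_sum)

lemma next_state_sum:
  "next_state A B (\<Sum>k\<in>S. x k) (\<Sum>k\<in>S. u k) (\<Sum>k\<in>S. \<xi> k) =
     (\<Sum>k\<in>S. next_state A B (x k) (u k) (\<xi> k))"
  by (simp add: next_state_def sum.distrib linear_sum[OF matrix_vector_mul_linear])

lemma next_state_scaleR:
  "next_state A B (c *\<^sub>R x) (c *\<^sub>R u) (c *\<^sub>R \<xi>) = c *\<^sub>R next_state A B x u \<xi>"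
  by (simp add: next_state_def matrix_vector_mult_scaleR scaleR_add_right)

theorem proposition4:
  fixes A :: "real^'n^'n" and B :: "real^'m^'n" and \<gamma> :: real
    and L :: "real^('n + 'm)^('n + 'm)"
    and M :: "'w measure" and w :: "'N::finite \<Rightarrow> 'w \<Rightarrow> real^'n" and \<Sigma> :: "real^'n^'n"
    and \<omega> :: 'w and \<xi> :: "'N \<Rightarrow> real^'n"
    and X Xp :: "real^'N^'n" and U :: "real^'N^'m"
    and xbar xpbar \<xi>bar :: "real^'n" and ubar :: "real^'m"
  assumes "0 < \<gamma>" and "\<gamma> < 1"
    and "stabilizable A B"
    and "psd L" and "pd (input_block L)"
    and "iid_noise M w \<Sigma>"
    and "\<omega> \<in> space M" and "\<And>k. \<xi> k = w k \<omega>"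
    and "\<And>k. column k Xp = next_state A B (column k X) (column k U) (\<xi> k)"
    and "xbar = (1 / real CARD('N)) *\<^sub>R (X *v 1)"
    and "ubar = (1 / real CARD('N)) *\<^sub>R (U *v 1)"
    and "xpbar = (1 / real CARD('N)) *\<^sub>R (Xp *v 1)"
    and "\<xi>bar = (1 / real CARD('N)) *\<^sub>R (\<Sum>k\<in>UNIV. \<xi> k)"
  shows "G A B \<gamma> xbar ubar \<xi>bar = outer xbar - \<gamma> *\<^sub>R outer xpbar"
proof -
  have "next_state A B xbar ubar \<xi>bar = xpbar"
    using assms(9) unfolding assms(10-13)
    by (simp add: mult_one_eq_sum_columns next_state_scaleR next_state_sum)
  then show ?thesis
    by (simp add: G_def)
qed

end
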